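(* Let $U_i(y_1,y_2)$, $i=0,\dots,n-1$, be the propagators $U_i(y_1,y_2)=P\exp\big(\int_{t_i}^{t_{i+1}}\mathcal{L}(s)ds\big)(y_1,y_2)$ of a Markov generator $\mathcal{L}$ on $A_m$ (time homogeneous in $[t_0,t_n]$) over the intervals $[t_i,t_{i+1}]$, $t_i=i\,\Delta T$, and let $\psi_i(y_1,y_2)$ be real functions. Let $\tilde U_i$ be the lifted joint propagator of the underlying process and of the discrete sum $J$ that increases by $\psi_i(y_{t_i},y_{t_{i+1}})$ over $[t_i,t_{i+1}]$, and for real $p$ let $\tilde U_{i,p}$ be the operator with matrix elements $$\tilde U_{i,p}(y_1;y_2)=U_i(y_1,y_2)\,e^{-ip\,\psi_i(y_1,y_2)}.$$ Then $$\Big(P\prod_{i=0}^{n-1}\tilde U_i\Big)(y_1,J_1;y_2,J_2)=\int\frac{dp}{2\pi}\,e^{ip(J_2-J_1)}\Big(P\prod_{i=0}^{n-1}\tilde U_{i,p}\Big)(y_1,y_2).$$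
   Context: $A_m$ is a finite lattice set. $P\prod_{i=0}^{n-1}M_i=M_0M_1\cdots M_{n-1}$ is the time-ordered product. The lifted propagator is obtained by discretizing $J\approx(\Delta J)k$ with integer $k$ and setting $\tilde U_i(y_1,k_1;y_2,k_2)=U_i(y_1,y_2)\,\delta\big(k_1-k_2+[\psi_i(y_1,y_2)(\Delta J)^{-1}]\big)$, with $[\cdot]$ the nearest integer; the identity is understood in the limit $\Delta J\to0$, in which $\tilde U_i$ becomes the kernel $U_i(y_1,y_2)\,\delta(J_2-J_1-\psi_i(y_1,y_2))$ (a distribution in $J_2$), and the $p$-integral over $\mathbb{R}$ is in the distributional sense. *)

theory Defs
  imports "HOL-Analysis.Analysis"
begin

section \<open>Time-ordered products and exponentials\<close>

text \<open>The product \<open>M 0 \<cdot> M 1 \<cdots> M (n - 1)\<close>, for any associative multiplication of kernels.\<close>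

primrec time_ordered_prod :: "('m \<Rightarrow> 'm \<Rightarrow> 'm) \<Rightarrow> 'm \<Rightarrow> (nat \<Rightarrow> 'm) \<Rightarrow> nat \<Rightarrow> 'm" where
  "time_ordered_prod f e M 0 = e"
| "time_ordered_prod f e M (Suc n) = f (time_ordered_prod f e M n) (M n)"

abbreviation matrix_prod :: "(nat \<Rightarrow> 'a::semiring_1^'y^'y) \<Rightarrow> nat \<Rightarrow> 'a^'y^'y" where
  "matrix_prod \<equiv> time_ordered_prod (**) (mat 1)"

text \<open>Kernels on a state space \<open>'y\<close> are matrices, with \<open>U(y1, y2) = U $ y1 $ y2\<close>.
  They act on functions of their second argument, so the rows of a generator sum to zero.\<close>

definition markov_generator :: "real^'y^'y \<Rightarrow> bool" where
  "markov_generator L \<longleftrightarrow>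
     (\<forall>y1 y2. y1 \<noteq> y2 \<longrightarrow> L $ y1 $ y2 \<ge> 0) \<and> (\<forall>y1. (\<Sum>y2\<in>UNIV. L $ y1 $ y2) = 0)"

text \<open>\<open>U\<close> is the time-ordered exponential of \<open>L\<close> over \<open>[a, b]\<close>: the limit of the time-ordered
  products of \<open>1 + (b - a)/N \<cdot> L(s\<^sub>k)\<close> over the uniform partition
  \<open>s\<^sub>k = a + k (b - a)/N\<close>, \<open>k < N\<close>.\<close>

definition has_ordered_exp :: "(real \<Rightarrow> real^'y^'y) \<Rightarrow> real \<Rightarrow> real \<Rightarrow> real^'y^'y \<Rightarrow> bool" where
  "has_ordered_exp L a b U \<longleftrightarrow>
     (\<lambda>N. matrix_prod (\<lambda>k. mat 1 + ((b - a) / real N) *\<^sub>R L (a + real k * ((b - a) / real N))) N)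
       \<longlonglongrightarrow> U"


section \<open>Tempered distributions on the real line\<close>

definition schwartz :: "(real \<Rightarrow> complex) \<Rightarrow> bool" where
  "schwartz \<phi> \<longleftrightarrow>
     (\<exists>D. D 0 = \<phi> \<and>
          (\<forall>m x. (D m has_vector_derivative D (Suc m) x) (at x)) \<and>
          (\<forall>m k. bounded (range (\<lambda>x. complex_of_real (x ^ k) * D m x))))"

text \<open>A distribution is represented by its pairing with test functions; only the values on
  Schwartz functions matter.\<close>

type_synonym distribution = "(real \<Rightarrow> complex) \<Rightarrow> complex"

definition regular_dist :: "(real \<Rightarrow> complex) \<Rightarrow> distribution" where
  "regular_dist f \<phi> = (LINT x|lborel. f x * \<phi> x)"

text \<open>The lattice weights \<open>w k\<close>, placed at the points \<open>h k\<close>. Equivalently, this is the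
  Riemann sum with mesh \<open>h\<close> of the density \<open>w k / h\<close> against the test function, so a Kronecker
  delta in \<open>k\<close> stands for a Dirac delta in \<open>J = h k\<close>.\<close>

definition lattice_dist :: "real \<Rightarrow> (int \<Rightarrow> real) \<Rightarrow> distribution" where
  "lattice_dist h w \<phi> = (\<Sum>\<^sub>\<infinity>k. complex_of_real (w k) * \<phi> (h * real_of_int k))"

definition dist_tendsto :: "('a \<Rightarrow> distribution) \<Rightarrow> distribution \<Rightarrow> 'a filter \<Rightarrow> bool" where
  "dist_tendsto T S F \<longleftrightarrow> (\<forall>\<phi>. schwartz \<phi> \<longrightarrow> ((\<lambda>h. T h \<phi>) \<longlongrightarrow> S \<phi>) F)"

text \<open>The integral over \<open>\<real>\<close> of a family of distributions, in the distributional sense.\<close>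

definition has_dist_integral :: "(real \<Rightarrow> distribution) \<Rightarrow> distribution \<Rightarrow> bool" where
  "has_dist_integral T S \<longleftrightarrow> (\<forall>\<phi>. schwartz \<phi> \<longrightarrow> has_bochner_integral lborel (\<lambda>p. T p \<phi>) (S \<phi>))"


section \<open>Lifted propagators\<close>

subsection \<open>On the lattice \<open>J = h k\<close>\<close>

definition kernel_comp :: "('a \<Rightarrow> 'a \<Rightarrow> real) \<Rightarrow> ('a \<Rightarrow> 'a \<Rightarrow> real) \<Rightarrow> 'a \<Rightarrow> 'a \<Rightarrow> real" where
  "kernel_comp K L x z = (\<Sum>\<^sub>\<infinity>y. K x y * L y z)"

definition kernel_id :: "'a \<Rightarrow> 'a \<Rightarrow> real" where
  "kernel_id x z = (if x = z then 1 else 0)"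

text \<open>The nearest integer is \<^const>\<open>round\<close>, which rounds half-integers up.\<close>

definition lattice_lift ::
  "real \<Rightarrow> real^'y^'y \<Rightarrow> ('y \<Rightarrow> 'y \<Rightarrow> real) \<Rightarrow> 'y \<times> int \<Rightarrow> 'y \<times> int \<Rightarrow> real" where
  "lattice_lift h U \<psi> = (\<lambda>(y1, k1) (y2, k2).
     U $ y1 $ y2 * (if k1 - k2 + round (\<psi> y1 y2 / h) = 0 then 1 else 0))"

subsection \<open>In the continuum\<close>

text \<open>\<open>K y1 J1 y2\<close> is the distribution in \<open>J2\<close> written \<open>K(y1, J1; y2, J2)\<close>.\<close>

type_synonym 'y dist_kernel = "'y \<Rightarrow> real \<Rightarrow> 'y \<Rightarrow> distribution"

text \<open>The pairing with \<open>\<phi>\<close> of the distribution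
  \<open>\<Sum>\<^sub>y \<integral> dJ K(y1, J1; y, J) L(y, J; y2, J2)\<close>.\<close>

definition dist_kernel_comp :: "'y::finite dist_kernel \<Rightarrow> 'y dist_kernel \<Rightarrow> 'y dist_kernel" where
  "dist_kernel_comp K L y1 J1 y2 \<phi> = (\<Sum>y\<in>UNIV. K y1 J1 y (\<lambda>J. L y J y2 \<phi>))"

definition dist_kernel_id :: "'y dist_kernel" where
  "dist_kernel_id y1 J1 y2 \<phi> = (if y1 = y2 then \<phi> J1 else 0)"

text \<open>The kernel \<open>U(y1, y2) \<delta>(J2 - J1 - \<psi>(y1, y2))\<close>.\<close>

definition dist_lift :: "real^'y^'y \<Rightarrow> ('y \<Rightarrow> 'y \<Rightarrow> real) \<Rightarrow> 'y dist_kernel" where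
  "dist_lift U \<psi> y1 J1 y2 \<phi> = complex_of_real (U $ y1 $ y2) * \<phi> (J1 + \<psi> y1 y2)"

subsection \<open>In Fourier space\<close>

definition fourier_lift :: "real^'y^'y \<Rightarrow> ('y \<Rightarrow> 'y \<Rightarrow> real) \<Rightarrow> real \<Rightarrow> complex^'y^'y" where
  "fourier_lift U \<psi> p =
     (\<chi> y1 y2. complex_of_real (U $ y1 $ y2) * exp (- \<i> * complex_of_real (p * \<psi> y1 y2)))"

end

theory Submission
  imports Defs "HOL-Probability.Characteristic_Functions" "HOL-Probability.Sinc_Integral"
begin

text \<open>
  Every lifted propagator is a kernel in the state times a shift in \<open>J\<close>: by \<open>\<psi>\<close> in the continuum,
  by the multiple of the mesh nearest to \<open>\<psi>\<close> on the lattice. In Fourier space the shift becomes the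
  phase \<open>exp (- \<i> p \<psi>)\<close>. All three time-ordered products therefore obey the same recursion:
  the last factor can be absorbed into the test function, as
  \<open>\<langle>W\<^bsub>n+1\<^esub>(y1, J1; y2), \<phi>\<rangle> = \<Sum>\<^sub>y \<langle>W\<^sub>n(y1, J1; y), U\<^sub>n(y, y2) \<phi>(\<sqdot> + \<psi>\<^sub>n(y, y2))\<rangle>\<close>. Both claims follow by induction on
  the number of factors, with the test function arbitrary.

  For the \<open>p\<close>-integral, the recursion for the Fourier side is a translation of the integration
  variable (\<open>regular_dist_fourier_Suc\<close>). The empty product is the Fourier inversion formula for
  Schwartz functions (\<open>schwartz_fourier_inversion\<close>), proved by inserting a Gaussian convergence
  factor.

  For the lattice limit, the shift in the recursion depends on the mesh \<open>h\<close>
  (\<open>lattice_dist_propagator_Suc\<close>), so absorbing a factor makes the test function depend on \<open>h\<close>.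
  The induction is carried by families \<open>\<Phi> h\<close> that converge continuously to \<open>\<phi>\<close>, meaning that
  \<open>\<Phi> h (X h)\<close> tends to \<open>\<phi> J\<close> whenever \<open>X h\<close> tends to \<open>J\<close>; rounded shifts preserve this property
  (\<open>lattice_propagator_tendsto\<close>).
\<close>

section \<open>Fourier inversion\<close>

lemma integral_char_std_normal:
  "(LINT q|lborel. iexp (s * q) * complex_of_real (std_normal_density q)) = exp (- (s\<^sup>2) / 2)"
proof -
  have "char std_normal_distribution s = complex_of_real (exp (- (s\<^sup>2) / 2))"
    by (simp add: char_std_normal_distribution)
  moreover have "char std_normal_distribution s
      = (LINT q|lborel. std_normal_density q *\<^sub>R iexp (s * q))"
    unfolding char_def by (subst integral_density) auto
  ultimately show ?thesis
    by (simp add: scaleR_conv_of_real mult.commute)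
qed

lemma integral_scaled_gaussian:
  fixes \<epsilon> b :: real
  assumes "\<epsilon> > 0"
  shows "(LINT p|lborel. iexp (p * b) * complex_of_real (std_normal_density (\<epsilon> * p)))
           = exp (- ((b / \<epsilon>)\<^sup>2) / 2) / \<epsilon>"
proof -
  have "(LINT p|lborel. iexp (p * b) * complex_of_real (std_normal_density (\<epsilon> * p)))
      = \<bar>1/\<epsilon>\<bar> *\<^sub>R (LINT q|lborel. iexp ((0 + (1/\<epsilon>) * q) * b)
          * complex_of_real (std_normal_density (\<epsilon> * (0 + (1/\<epsilon>) * q))))"
    using assms by (intro lborel_integral_real_affine) simp
  also have "(\<lambda>q. iexp ((0 + (1/\<epsilon>) * q) * b)
          * complex_of_real (std_normal_density (\<epsilon> * (0 + (1/\<epsilon>) * q))))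
      = (\<lambda>q. iexp (b / \<epsilon> * q) * complex_of_real (std_normal_density q))"
    using assms by (auto simp: fun_eq_iff mult_ac)
  finally show ?thesis
    using assms by (simp only: integral_char_std_normal) (simp add: scaleR_conv_of_real field_simps)
qed

lemma integrable_std_normal_density_scaled:
  assumes "(\<epsilon>::real) > 0"
  shows "integrable lborel (\<lambda>p. std_normal_density (\<epsilon> * p))"
  using lborel_integrable_real_affine[of "std_normal_density" \<epsilon> 0] assms by simp

text \<open>With the convergence factor the double integral is absolutely convergent, so the \<open>p\<close>-integral
  can be done first. It gives a Gaussian of width \<open>\<epsilon>\<close> around \<open>a\<close>, and \<open>y = (x - a) / \<epsilon>\<close> rescales
  it to unit width.\<close>

lemma gaussian_regularised_inversion:
  fixes f :: "real \<Rightarrow> complex" and a \<epsilon> :: real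
  assumes f: "integrable lborel f" and \<epsilon>: "\<epsilon> > 0"
  shows "(LINT p|lborel. (LINT x|lborel. iexp (p * (x - a)) * f x)
              * complex_of_real (std_normal_density (\<epsilon> * p)))
       = (LINT y|lborel. f (a + \<epsilon> * y) * complex_of_real (exp (- (y\<^sup>2) / 2)))"
proof -
  let ?n = "\<lambda>p. complex_of_real (std_normal_density (\<epsilon> * p))"
  let ?H = "\<lambda>p x. iexp (p * (x - a)) * f x * ?n p"
  have [measurable]: "f \<in> borel_measurable borel"
    using f by auto
  have int_n: "integrable lborel (\<lambda>p. std_normal_density (\<epsilon> * p))"
    by (rule integrable_std_normal_density_scaled[OF \<epsilon>])
  have int_H: "integrable (lborel \<Otimes>\<^sub>M lborel) (\<lambda>(p, x). ?H p x)"
  proof (rule lborel_pair.Fubini_integrable)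
    show "(\<lambda>(p, x). ?H p x) \<in> borel_measurable (lborel \<Otimes>\<^sub>M lborel)"
      by measurable
    show "integrable lborel (\<lambda>p. LINT x|lborel. norm (case (p, x) of (p, x) \<Rightarrow> ?H p x))"
      using int_n by (simp add: norm_mult)
    show "AE p in lborel. integrable lborel (\<lambda>x. case (p, x) of (p, x) \<Rightarrow> ?H p x)"
    proof (intro AE_I2)
      fix p :: real
      have "integrable lborel (\<lambda>x. iexp (p * (x - a)) * f x)"
        by (rule Bochner_Integration.integrable_bound[OF f]) (auto simp: norm_mult)
      then show "integrable lborel (\<lambda>x. case (p, x) of (p, x) \<Rightarrow> ?H p x)"
        by simp
    qed
  qed
  have "(LINT p|lborel. (LINT x|lborel. iexp (p * (x - a)) * f x) * ?n p)
      = (LINT p|lborel. LINT x|lborel. ?H p x)"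
    by simp
  also have "\<dots> = (LINT x|lborel. LINT p|lborel. ?H p x)"
    by (rule lborel_pair.Fubini_integral[symmetric, OF int_H])
  also have "\<dots> = (LINT x|lborel. f x * complex_of_real (exp (- (((x - a) / \<epsilon>)\<^sup>2) / 2) / \<epsilon>))"
  proof (intro Bochner_Integration.integral_cong refl)
    fix x :: real
    have "(LINT p|lborel. ?H p x) = f x * (LINT p|lborel. iexp (p * (x - a)) * ?n p)"
      by (subst integral_mult_right_zero[symmetric]) (simp add: mult_ac)
    then show "(LINT p|lborel. ?H p x) = f x * complex_of_real (exp (- (((x - a) / \<epsilon>)\<^sup>2) / 2) / \<epsilon>)"
      by (simp only: integral_scaled_gaussian[OF \<epsilon>])
  qed
  also have "\<dots> = \<bar>\<epsilon>\<bar> *\<^sub>R (LINT y|lborel. f (a + \<epsilon> * y)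
        * complex_of_real (exp (- (((a + \<epsilon> * y - a) / \<epsilon>)\<^sup>2) / 2) / \<epsilon>))"
    using \<epsilon> by (intro lborel_integral_real_affine) simp
  also have "\<dots> = (LINT y|lborel. f (a + \<epsilon> * y) * complex_of_real (exp (- (y\<^sup>2) / 2)))"
    using \<epsilon> by (simp add: scaleR_conv_of_real)
  finally show ?thesis .
qed

text \<open>As \<open>\<epsilon>\<close> tends to 0, dominated convergence applies to both sides of the regularised identity: on
  the left the factor flattens to the constant \<open>1 / sqrt (2 pi)\<close>, on the right \<open>f (a + \<epsilon> y)\<close> tends to
  \<open>f a\<close> under a Gaussian of total mass \<open>sqrt (2 pi)\<close>. The two constants combine to \<open>2 pi\<close>.\<close>

lemma fourier_inversion:
  fixes f :: "real \<Rightarrow> complex" and a :: real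
  assumes f: "integrable lborel f" "bounded (range f)" "isCont f a"
    and F: "integrable lborel (\<lambda>p. LINT x|lborel. iexp (p * (x - a)) * f x)"
  shows "(LINT p|lborel. LINT x|lborel. iexp (p * (x - a)) * f x) = 2 * pi * f a"
proof -
  let ?F = "\<lambda>p. LINT x|lborel. iexp (p * (x - a)) * f x"
  let ?\<epsilon> = "\<lambda>k. inverse (real (Suc k))"
  have [measurable]: "f \<in> borel_measurable borel" "?F \<in> borel_measurable borel"
    using f F by auto
  obtain B where B: "\<And>x. norm (f x) \<le> B"
    using f(2) by (auto simp: bounded_iff)
  have gauss: "(\<lambda>y. exp (- (y\<^sup>2) / 2)) = (\<lambda>y. sqrt (2 * pi) * std_normal_density y)"
    by (simp add: std_normal_density_def fun_eq_iff)
  have integral_gauss: "(LINT y|lborel. exp (- (y\<^sup>2) / 2)) = sqrt (2 * pi)"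
    unfolding gauss using integral_std_normal_moment_even[of 0] by simp
  have int_gauss: "integrable lborel (\<lambda>y::real. exp (- (y\<^sup>2) / 2))"
    unfolding gauss by simp
  have \<epsilon>0: "?\<epsilon> \<longlonglongrightarrow> 0"
    by (rule LIMSEQ_inverse_real_of_nat)
  have lim_F: "(\<lambda>k. LINT p|lborel. ?F p * complex_of_real (std_normal_density (?\<epsilon> k * p)))
      \<longlonglongrightarrow> (LINT p|lborel. ?F p * complex_of_real (1 / sqrt (2 * pi)))"
  proof (rule integral_dominated_convergence)
    show "integrable lborel (\<lambda>p. norm (?F p) * (1 / sqrt (2 * pi)))"
      using F by simp
    show "AE p in lborel. (\<lambda>k. ?F p * complex_of_real (std_normal_density (?\<epsilon> k * p)))
        \<longlonglongrightarrow> ?F p * complex_of_real (1 / sqrt (2 * pi))"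
    proof (intro AE_I2 tendsto_mult tendsto_const tendsto_of_real)
      fix p :: real
      have "(\<lambda>k. 1 / sqrt (2 * pi) * exp (- (?\<epsilon> k * p)\<^sup>2 / 2))
          \<longlonglongrightarrow> 1 / sqrt (2 * pi) * exp (- (0 * p)\<^sup>2 / 2)"
        by (intro tendsto_intros \<epsilon>0) auto
      then show "(\<lambda>k. std_normal_density (?\<epsilon> k * p)) \<longlonglongrightarrow> 1 / sqrt (2 * pi)"
        by (simp add: std_normal_density_def)
    qed
    show "AE p in lborel. norm (?F p * complex_of_real (std_normal_density (?\<epsilon> k * p)))
        \<le> norm (?F p) * (1 / sqrt (2 * pi))" for k
    proof (intro AE_I2)
      fix p :: real
      have "std_normal_density (?\<epsilon> k * p) \<le> 1 / sqrt (2 * pi) * 1"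
        unfolding std_normal_density_def by (intro mult_left_mono) auto
      then have "norm (?F p) * std_normal_density (?\<epsilon> k * p) \<le> norm (?F p) * (1 / sqrt (2 * pi))"
        by (intro mult_left_mono) auto
      then show "norm (?F p * complex_of_real (std_normal_density (?\<epsilon> k * p)))
          \<le> norm (?F p) * (1 / sqrt (2 * pi))"
        by (simp add: norm_mult)
    qed
  qed auto
  have lim_f: "(\<lambda>k. LINT y|lborel. f (a + ?\<epsilon> k * y) * complex_of_real (exp (- (y\<^sup>2) / 2)))
      \<longlonglongrightarrow> (LINT y|lborel. f a * complex_of_real (exp (- (y\<^sup>2) / 2)))"
  proof (rule integral_dominated_convergence)
    show "integrable lborel (\<lambda>y. B * exp (- (y\<^sup>2) / 2))"
      using int_gauss by simp
    show "AE y in lborel. (\<lambda>k. f (a + ?\<epsilon> k * y) * complex_of_real (exp (- (y\<^sup>2) / 2)))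
        \<longlonglongrightarrow> f a * complex_of_real (exp (- (y\<^sup>2) / 2))"
    proof (intro AE_I2 tendsto_mult tendsto_const)
      fix y :: real
      have "(\<lambda>k. a + ?\<epsilon> k * y) \<longlonglongrightarrow> a + 0 * y"
        by (intro tendsto_intros \<epsilon>0)
      then show "(\<lambda>k. f (a + ?\<epsilon> k * y)) \<longlonglongrightarrow> f a"
        using isCont_tendsto_compose[OF f(3)] by simp
    qed
    show "AE y in lborel. norm (f (a + ?\<epsilon> k * y) * complex_of_real (exp (- (y\<^sup>2) / 2)))
        \<le> B * exp (- (y\<^sup>2) / 2)" for k
      using B by (intro AE_I2) (simp add: norm_mult mult_right_mono)
  qed auto
  have "(LINT p|lborel. ?F p * complex_of_real (1 / sqrt (2 * pi)))
      = (LINT y|lborel. f a * complex_of_real (exp (- (y\<^sup>2) / 2)))"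
  proof (rule LIMSEQ_unique[OF lim_F])
    show "(\<lambda>k. LINT p|lborel. ?F p * complex_of_real (std_normal_density (?\<epsilon> k * p)))
        \<longlonglongrightarrow> (LINT y|lborel. f a * complex_of_real (exp (- (y\<^sup>2) / 2)))"
      using lim_f by (subst gaussian_regularised_inversion[OF f(1)]) auto
  qed
  also have "\<dots> = f a * complex_of_real (sqrt (2 * pi))"
    by (simp only: integral_mult_right_zero integral_complex_of_real integral_gauss)
  finally have "(LINT p|lborel. ?F p) / complex_of_real (sqrt (2 * pi))
      = f a * complex_of_real (sqrt (2 * pi))"
    by simp
  then have "(LINT p|lborel. ?F p)
      = f a * (complex_of_real (sqrt (2 * pi)) * complex_of_real (sqrt (2 * pi)))"
    by (simp add: field_simps)
  also have "complex_of_real (sqrt (2 * pi)) * complex_of_real (sqrt (2 * pi)) = 2 * pi"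
    by (simp flip: of_real_mult)
  finally show ?thesis
    by simp
qed

section \<open>Schwartz functions\<close>

lemma schwartz_deriv:
  assumes "schwartz \<phi>"
  obtains \<phi>' where "schwartz \<phi>'" "\<And>x. (\<phi> has_vector_derivative \<phi>' x) (at x)"
proof -
  obtain D where D: "D 0 = \<phi>" "\<And>m x. (D m has_vector_derivative D (Suc m) x) (at x)"
    "\<And>m k. bounded (range (\<lambda>x. complex_of_real (x ^ k) * D m x))"
    using assms unfolding schwartz_def by blast
  have "schwartz (D 1)"
    unfolding schwartz_def using D by (intro exI[of _ "\<lambda>m. D (Suc m)"]) auto
  with D show ?thesis
    by (intro that[of "D 1"]) (auto simp flip: D(1))
qed

lemma schwartz_moment_bounded:
  assumes "schwartz \<phi>"
  shows "bounded (range (\<lambda>x. complex_of_real (x ^ k) * \<phi> x))"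
  using assms unfolding schwartz_def by metis

lemma schwartz_bounded: "schwartz \<phi> \<Longrightarrow> bounded (range \<phi>)"
  using schwartz_moment_bounded[of \<phi> 0] by simp

lemma schwartz_isCont: "schwartz \<phi> \<Longrightarrow> isCont \<phi> x"
  by (metis schwartz_deriv has_vector_derivative_continuous)

lemma schwartz_measurable: "schwartz \<phi> \<Longrightarrow> \<phi> \<in> borel_measurable borel"
  by (simp add: borel_measurable_continuous_onI continuous_at_imp_continuous_on schwartz_isCont)

lemma integrable_lborel_inverse_1_plus_square:
  "integrable lborel (\<lambda>x::real. inverse (1 + x\<^sup>2))"
  using integrable_inverse_1_plus_square by (simp add: set_integrable_def)

lemma integrable_if_quadratic_decay:
  fixes f :: "real \<Rightarrow> complex"
  assumes [measurable]: "f \<in> borel_measurable borel"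
    and "\<And>x. norm (f x) \<le> A" and "\<And>x. x\<^sup>2 * norm (f x) \<le> B"
  shows "integrable lborel f"
proof (rule Bochner_Integration.integrable_bound)
  show "integrable lborel (\<lambda>x. (A + B) * inverse (1 + x\<^sup>2))"
    using integrable_lborel_inverse_1_plus_square by simp
  have "norm (f x) \<le> (A + B) * inverse (1 + x\<^sup>2)" for x
  proof -
    have "norm (f x) * (1 + x\<^sup>2) \<le> A + B"
      using assms(2,3)[of x] by (simp add: algebra_simps)
    then show ?thesis
      by (simp add: divide_simps add_pos_nonneg flip: divide_inverse)
  qed
  then show "AE x in lborel. norm (f x) \<le> norm ((A + B) * inverse (1 + x\<^sup>2))"
    by (intro AE_I2) (smt (verit) real_norm_def)
qed auto

lemma schwartz_integrable:
  assumes "schwartz \<phi>"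
  shows "integrable lborel \<phi>"
proof -
  obtain A where A: "\<And>x. norm (\<phi> x) \<le> A"
    using schwartz_bounded[OF assms] by (auto simp: bounded_iff)
  obtain B where B: "\<And>x. norm (complex_of_real (x\<^sup>2) * \<phi> x) \<le> B"
    using schwartz_moment_bounded[OF assms, of 2] by (auto simp: bounded_iff)
  show ?thesis
    using schwartz_measurable[OF assms] A B
    by (intro integrable_if_quadratic_decay) (auto simp: norm_mult norm_power)
qed

lemma power_add_le:
  fixes u v :: real
  assumes "u \<ge> 0" "v \<ge> 0"
  shows "(u + v) ^ k \<le> 2 ^ k * (u ^ k + v ^ k)"
proof -
  have "(u + v) ^ k \<le> (2 * max u v) ^ k"
    using assms by (intro power_mono) auto
  also have "\<dots> = 2 ^ k * max u v ^ k"
    by (simp add: power_mult_distrib)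
  also have "\<dots> \<le> 2 ^ k * (u ^ k + v ^ k)"
    using assms by (intro mult_left_mono) (auto simp: max_def)
  finally show ?thesis .
qed

lemma bounded_moments_translate:
  fixes g :: "real \<Rightarrow> complex"
  assumes "\<And>k. bounded (range (\<lambda>x. complex_of_real (x ^ k) * g x))"
  shows "bounded (range (\<lambda>x. complex_of_real (x ^ k) * g (x + a)))"
proof -
  obtain A where A: "\<And>x. norm (g x) \<le> A"
    using assms[of 0] by (auto simp: bounded_iff)
  obtain B where B: "\<And>x. \<bar>x\<bar> ^ k * norm (g x) \<le> B"
    using assms[of k] by (auto simp: bounded_iff norm_mult norm_power power_abs)
  have "norm (complex_of_real (x ^ k) * g (x + a)) \<le> 2 ^ k * (B + \<bar>a\<bar> ^ k * A)" for x
  proof -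
    have "\<bar>x\<bar> ^ k \<le> (\<bar>x + a\<bar> + \<bar>a\<bar>) ^ k"
      by (intro power_mono) auto
    also have "\<dots> \<le> 2 ^ k * (\<bar>x + a\<bar> ^ k + \<bar>a\<bar> ^ k)"
      by (rule power_add_le) auto
    finally have "\<bar>x\<bar> ^ k * norm (g (x + a)) \<le> 2 ^ k * (\<bar>x + a\<bar> ^ k + \<bar>a\<bar> ^ k) * norm (g (x + a))"
      by (rule mult_right_mono) simp
    also have "\<dots> = 2 ^ k * (\<bar>x + a\<bar> ^ k * norm (g (x + a)) + \<bar>a\<bar> ^ k * norm (g (x + a)))"
      by (simp add: algebra_simps)
    also have "\<dots> \<le> 2 ^ k * (B + \<bar>a\<bar> ^ k * A)"
      using A B by (intro mult_left_mono add_mono) auto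
    finally show ?thesis
      by (simp add: norm_mult norm_power power_abs)
  qed
  then show ?thesis
    by (auto simp: bounded_iff)
qed

text \<open>Exactly these operations act on the test function when a propagator is absorbed into it.\<close>

lemma schwartz_scale_translate:
  assumes "schwartz \<phi>"
  shows "schwartz (\<lambda>x. c * \<phi> (x + a))"
proof -
  obtain D where D: "D 0 = \<phi>" "\<And>m x. (D m has_vector_derivative D (Suc m) x) (at x)"
    "\<And>m k. bounded (range (\<lambda>x. complex_of_real (x ^ k) * D m x))"
    using assms unfolding schwartz_def by blast
  have "((\<lambda>x. c * D m (x + a)) has_vector_derivative c * D (Suc m) (x + a)) (at x)" for m x
  proof -
    have "(D m \<circ> (\<lambda>x. x + a) has_vector_derivative 1 *\<^sub>R D (Suc m) (x + a)) (at x)"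
      by (rule vector_diff_chain_at) (auto intro!: derivative_eq_intros D(2))
    then show ?thesis
      by (auto simp: o_def intro: has_vector_derivative_mult_right)
  qed
  moreover have "bounded (range (\<lambda>x. complex_of_real (x ^ k) * (c * D m (x + a))))" for m k
  proof -
    have "bounded ((\<lambda>z. c * z) ` range (\<lambda>x. complex_of_real (x ^ k) * D m (x + a)))"
      by (intro bounded_linear_image bounded_linear_mult_right bounded_moments_translate D(3))
    then show ?thesis
      by (simp add: image_image mult_ac)
  qed
  ultimately show ?thesis
    unfolding schwartz_def using D(1)
    by (intro exI[of _ "\<lambda>m x. c * D m (x + a)"]) auto
qed

lemma schwartz_tendsto_0:
  assumes "schwartz \<phi>" "F \<le> at_infinity"
  shows "(\<phi> \<longlongrightarrow> 0) F"
proof -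
  obtain B where B: "\<And>x. norm (complex_of_real (x ^ 1) * \<phi> x) \<le> B"
    using schwartz_moment_bounded[OF assms(1), of 1] by (auto simp: bounded_iff)
  have "(\<phi> \<longlongrightarrow> 0) at_infinity"
  proof (rule Lim_null_comparison)
    show "\<forall>\<^sub>F x in at_infinity. norm (\<phi> x) \<le> B * norm (inverse x)"
      unfolding eventually_at_infinity
    proof (intro exI[of _ 1] allI impI)
      fix x :: real
      assume "1 \<le> norm x"
      then show "norm (\<phi> x) \<le> B * norm (inverse x)"
        using B[of x] by (simp add: norm_mult field_simps)
    qed
    have "((\<lambda>x::real. B * norm (inverse x)) \<longlongrightarrow> B * norm (0::real)) at_infinity"
      by (intro tendsto_intros tendsto_inverse_0)
    then show "((\<lambda>x::real. B * norm (inverse x)) \<longlongrightarrow> 0) at_infinity"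
      by simp
  qed
  then show ?thesis
    using assms(2) tendsto_mono by blast
qed

lemma integrable_iexp_mult:
  fixes f :: "real \<Rightarrow> complex"
  assumes "integrable lborel f"
  shows "integrable lborel (\<lambda>x. iexp (p * (x - a)) * f x)"
proof (rule Bochner_Integration.integrable_bound[OF assms])
  have [measurable]: "f \<in> borel_measurable borel"
    using assms by auto
  show "(\<lambda>x. iexp (p * (x - a)) * f x) \<in> borel_measurable lborel"
    by measurable
qed (auto simp: norm_mult)

text \<open>Integration by parts; the boundary terms vanish at infinity.\<close>

lemma fourier_transform_deriv:
  fixes p a :: real
  assumes "schwartz \<phi>" "schwartz \<phi>'" "\<And>x. (\<phi> has_vector_derivative \<phi>' x) (at x)"
  shows "(LINT x|lborel. iexp (p * (x - a)) * \<phi>' x)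
           = - (\<i> * p) * (LINT x|lborel. iexp (p * (x - a)) * \<phi> x)"
proof -
  let ?g = "\<lambda>x. iexp (p * (x - a)) * \<phi> x"
  let ?g' = "\<lambda>x. \<i> * p * (iexp (p * (x - a)) * \<phi> x) + iexp (p * (x - a)) * \<phi>' x"
  have int: "integrable lborel (\<lambda>x. iexp (p * (x - a)) * \<phi> x)"
    "integrable lborel (\<lambda>x. iexp (p * (x - a)) * \<phi>' x)"
    by (intro integrable_iexp_mult schwartz_integrable assms)+
  have lim: "(?g \<longlongrightarrow> 0) F" if "F \<le> at_infinity" for F
    using schwartz_tendsto_0[OF assms(1) that]
    by (subst tendsto_norm_zero_iff[symmetric]) (simp add: norm_mult tendsto_norm_zero)
  have "(LBINT x=-\<infinity>..\<infinity>. ?g' x) = 0 - 0"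
  proof (rule interval_integral_FTC_integrable)
    show "(?g has_vector_derivative ?g' x) (at x)" for x
    proof -
      have "((\<lambda>x. iexp (p * (x - a))) has_vector_derivative \<i> * p * iexp (p * (x - a))) (at x)"
      proof -
        have "(iexp \<circ> (\<lambda>x. p * (x - a)) has_vector_derivative p *\<^sub>R (\<i> * iexp (p * (x - a)))) (at x)"
          by (rule vector_diff_chain_at) (auto intro!: derivative_eq_intros)
        then show ?thesis
          by (simp add: o_def scaleR_conv_of_real mult_ac)
      qed
      from has_vector_derivative_mult[OF this assms(3)] show ?thesis
        by (simp add: algebra_simps)
    qed
    show "isCont ?g' x" for x
      by (intro continuous_intros schwartz_isCont assms)
    show "set_integrable lborel (einterval (- \<infinity>) \<infinity>) ?g'"
      using int by (simp add: set_integrable_def)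
    show "((?g \<circ> real_of_ereal) \<longlongrightarrow> 0) (at_right (- \<infinity>))"
      unfolding ereal_tendsto_simps by (rule lim) (simp add: at_bot_le_at_infinity)
    show "((?g \<circ> real_of_ereal) \<longlongrightarrow> 0) (at_left \<infinity>)"
      unfolding ereal_tendsto_simps by (rule lim) (simp add: at_top_le_at_infinity)
  qed simp
  then have "(LINT x|lborel. ?g' x) = 0"
    by (simp add: interval_lebesgue_integral_def set_lebesgue_integral_def)
  then show ?thesis
    using int by (simp add: add_eq_0_iff)
qed

text \<open>Two integrations by parts bound \<open>p\<^sup>2\<close> times the transform by the \<open>L\<^sup>1\<close> norm of the second
  derivative.\<close>

lemma fourier_transform_integrable:
  assumes "schwartz \<phi>"
  shows "integrable lborel (\<lambda>p. LINT x|lborel. iexp (p * (x - a)) * \<phi> x)"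
proof -
  obtain \<phi>' where \<phi>': "schwartz \<phi>'" "\<And>x. (\<phi> has_vector_derivative \<phi>' x) (at x)"
    using schwartz_deriv[OF assms] by blast
  obtain \<phi>'' where \<phi>'': "schwartz \<phi>''" "\<And>x. (\<phi>' has_vector_derivative \<phi>'' x) (at x)"
    using schwartz_deriv[OF \<phi>'(1)] by blast
  have [measurable]: "\<phi> \<in> borel_measurable borel"
    by (rule schwartz_measurable[OF assms])
  have bound: "norm (LINT x|lborel. iexp (p * (x - a)) * f x) \<le> (LINT x|lborel. norm (f x))" for p f
    using integral_norm_bound[of lborel "\<lambda>x. iexp (p * (x - a)) * f x"] by (simp add: norm_mult)
  show ?thesis
  proof (rule integrable_if_quadratic_decay)
    show "(\<lambda>p. LINT x|lborel. iexp (p * (x - a)) * \<phi> x) \<in> borel_measurable borel"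
      by measurable
    show "norm (LINT x|lborel. iexp (p * (x - a)) * \<phi> x) \<le> (LINT x|lborel. norm (\<phi> x))" for p
      by (rule bound)
    show "p\<^sup>2 * norm (LINT x|lborel. iexp (p * (x - a)) * \<phi> x) \<le> (LINT x|lborel. norm (\<phi>'' x))" for p
    proof -
      have "(LINT x|lborel. iexp (p * (x - a)) * \<phi>'' x)
          = - (p\<^sup>2 * (LINT x|lborel. iexp (p * (x - a)) * \<phi> x))"
        unfolding fourier_transform_deriv[OF \<phi>'(1) \<phi>''] fourier_transform_deriv[OF assms \<phi>']
        by (simp add: power2_eq_square mult_ac)
      then show ?thesis
        using bound[of p \<phi>''] by (simp add: norm_mult norm_power)
    qed
  qed
qed

lemma schwartz_fourier_inversion:
  assumes "schwartz \<phi>"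
  shows "has_bochner_integral lborel (\<lambda>p. LINT x|lborel. iexp (p * (x - a)) / (2 * pi) * \<phi> x) (\<phi> a)"
proof -
  have "has_bochner_integral lborel (\<lambda>p. LINT x|lborel. iexp (p * (x - a)) * \<phi> x) (2 * pi * \<phi> a)"
    using fourier_inversion[of \<phi> a] fourier_transform_integrable[OF assms]
      schwartz_integrable[OF assms] schwartz_bounded[OF assms] schwartz_isCont[OF assms]
    by (simp add: has_bochner_integral_iff)
  from has_bochner_integral_divide_zero[OF this, of "2 * pi"] show ?thesis
    by simp
qed

section \<open>Products of lifted propagators\<close>

abbreviation dist_propagator ::
  "(nat \<Rightarrow> real^'y^'y) \<Rightarrow> (nat \<Rightarrow> 'y \<Rightarrow> 'y \<Rightarrow> real) \<Rightarrow> nat \<Rightarrow> 'y::finite dist_kernel" where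
  "dist_propagator U \<psi> \<equiv>
     time_ordered_prod dist_kernel_comp dist_kernel_id (\<lambda>i. dist_lift (U i) (\<psi> i))"

abbreviation lattice_propagator ::
  "real \<Rightarrow> (nat \<Rightarrow> real^'y^'y) \<Rightarrow> (nat \<Rightarrow> 'y \<Rightarrow> 'y \<Rightarrow> real) \<Rightarrow> nat
     \<Rightarrow> 'y::finite \<times> int \<Rightarrow> 'y \<times> int \<Rightarrow> real" where
  "lattice_propagator h U \<psi> \<equiv>
     time_ordered_prod kernel_comp kernel_id (\<lambda>i. lattice_lift h (U i) (\<psi> i))"

abbreviation fourier_propagator ::
  "(nat \<Rightarrow> real^'y^'y) \<Rightarrow> (nat \<Rightarrow> 'y \<Rightarrow> 'y \<Rightarrow> real) \<Rightarrow> real \<Rightarrow> nat \<Rightarrow> complex^'y^'y::finite" where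
  "fourier_propagator U \<psi> p \<equiv> matrix_prod (\<lambda>i. fourier_lift (U i) (\<psi> i) p)"

lemma dist_propagator_Suc:
  "dist_propagator U \<psi> (Suc n) y1 J1 y2 \<phi>
     = (\<Sum>y\<in>UNIV. dist_propagator U \<psi> n y1 J1 y
          (\<lambda>J. complex_of_real (U n $ y $ y2) * \<phi> (J + \<psi> n y y2)))"
  by (simp add: dist_kernel_comp_def dist_lift_def)

section \<open>The Fourier representation\<close>

text \<open>The phase \<open>exp (- \<i> p \<psi>)\<close> of the last factor cancels against the substitution
  \<open>J2 = J + \<psi>\<close> in \<open>exp (\<i> p (J2 - J1))\<close>, which moves the shift onto the test function.\<close>

lemma regular_dist_fourier_Suc:
  assumes "schwartz \<phi>"
  shows "regular_dist (\<lambda>J2. iexp (p * (J2 - J1)) / (2 * pi)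
             * fourier_propagator U \<psi> p (Suc n) $ y1 $ y2) \<phi>
       = (\<Sum>y\<in>UNIV. regular_dist (\<lambda>J2. iexp (p * (J2 - J1)) / (2 * pi)
             * fourier_propagator U \<psi> p n $ y1 $ y)
             (\<lambda>J. complex_of_real (U n $ y $ y2) * \<phi> (J + \<psi> n y y2)))"
proof -
  let ?M = "fourier_propagator U \<psi> p n"
  let ?I = "\<lambda>y J2. iexp (p * (J2 - J1)) / (2 * pi) * (?M $ y1 $ y * (U n $ y $ y2)
               * exp (- \<i> * complex_of_real (p * \<psi> n y y2))) * \<phi> J2"
  have int: "integrable lborel (?I y)" for y
  proof -
    have "integrable lborel (\<lambda>J2. (?M $ y1 $ y * (U n $ y $ y2)
               * exp (- \<i> * complex_of_real (p * \<psi> n y y2)) / (2 * pi))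
               * (iexp (p * (J2 - J1)) * \<phi> J2))"
      by (intro integrable_mult_right integrable_iexp_mult schwartz_integrable assms)
    then show ?thesis
      by (simp add: mult_ac)
  qed
  have "regular_dist (\<lambda>J2. iexp (p * (J2 - J1)) / (2 * pi)
             * fourier_propagator U \<psi> p (Suc n) $ y1 $ y2) \<phi>
      = (LINT J2|lborel. (\<Sum>y\<in>UNIV. ?I y J2))"
    unfolding regular_dist_def
    by (simp add: matrix_matrix_mult_def fourier_lift_def sum_distrib_left sum_distrib_right
        sum_divide_distrib mult_ac)
  also have "\<dots> = (\<Sum>y\<in>UNIV. LINT J2|lborel. ?I y J2)"
    by (rule Bochner_Integration.integral_sum) (rule int)
  also have "\<dots> = (\<Sum>y\<in>UNIV. regular_dist (\<lambda>J2. iexp (p * (J2 - J1)) / (2 * pi) * ?M $ y1 $ y)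
             (\<lambda>J. complex_of_real (U n $ y $ y2) * \<phi> (J + \<psi> n y y2)))"
  proof (intro sum.cong refl)
    fix y
    have "(LINT J2|lborel. ?I y J2) = \<bar>1\<bar> *\<^sub>R (LINT J|lborel. ?I y (\<psi> n y y2 + 1 * J))"
      by (rule lborel_integral_real_affine) simp
    also have "(\<lambda>J. ?I y (\<psi> n y y2 + 1 * J)) = (\<lambda>J. iexp (p * (J - J1)) / (2 * pi) * ?M $ y1 $ y
               * (complex_of_real (U n $ y $ y2) * \<phi> (J + \<psi> n y y2)))"
    proof
      fix J
      have "iexp (p * (\<psi> n y y2 + 1 * J - J1)) * exp (- \<i> * complex_of_real (p * \<psi> n y y2))
          = iexp (p * (J - J1))"
        by (simp add: algebra_simps flip: exp_add)
      then show "?I y (\<psi> n y y2 + 1 * J) = iexp (p * (J - J1)) / (2 * pi) * ?M $ y1 $ y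
               * (complex_of_real (U n $ y $ y2) * \<phi> (J + \<psi> n y y2))"
        by (simp add: add.commute mult_ac)
    qed
    finally show "(LINT J2|lborel. ?I y J2)
        = regular_dist (\<lambda>J2. iexp (p * (J2 - J1)) / (2 * pi) * ?M $ y1 $ y)
             (\<lambda>J. complex_of_real (U n $ y $ y2) * \<phi> (J + \<psi> n y y2))"
      by (simp add: regular_dist_def)
  qed
  finally show ?thesis .
qed

lemma has_dist_integral_fourier_propagator:
  "has_dist_integral
     (\<lambda>p. regular_dist (\<lambda>J2. iexp (p * (J2 - J1)) / (2 * pi)
            * fourier_propagator U \<psi> p n $ y1 $ y2))
     (dist_propagator U \<psi> n y1 J1 y2)"
  unfolding has_dist_integral_def
proof (intro allI impI)
  fix \<phi> :: "real \<Rightarrow> complex"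
  assume "schwartz \<phi>"
  then show "has_bochner_integral lborel
      (\<lambda>p. regular_dist (\<lambda>J2. iexp (p * (J2 - J1)) / (2 * pi)
            * fourier_propagator U \<psi> p n $ y1 $ y2) \<phi>)
      (dist_propagator U \<psi> n y1 J1 y2 \<phi>)"
  proof (induction n arbitrary: y2 \<phi>)
    case 0
    show ?case
      using schwartz_fourier_inversion[OF 0, of J1]
      by (auto simp: regular_dist_def dist_kernel_id_def mat_def)
  next
    case (Suc n)
    show ?case
      unfolding dist_propagator_Suc regular_dist_fourier_Suc[OF Suc.prems]
      by (intro has_bochner_integral_sum Suc.IH schwartz_scale_translate Suc.prems)
  qed
qed

section \<open>The lattice limit\<close>

text \<open>For each intermediate state the Kronecker delta leaves a single intermediate \<open>k\<close>, so the
  infinite sum is finite for every kernel on the left.\<close>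

lemma kernel_comp_lattice_lift:
  "kernel_comp K (lattice_lift h U \<psi>) x (y2, k2)
     = (\<Sum>y\<in>UNIV. K x (y, k2 - round (\<psi> y y2 / h)) * U $ y $ (y2::'y::finite))"
proof -
  let ?g = "\<lambda>y. (y, k2 - round (\<psi> y y2 / h))"
  let ?f = "\<lambda>z. K x z * lattice_lift h U \<psi> z (y2, k2)"
  have "kernel_comp K (lattice_lift h U \<psi>) x (y2, k2) = infsum ?f (range ?g)"
    unfolding kernel_comp_def
    by (rule infsum_cong_neutral) (auto simp: lattice_lift_def image_iff)
  also have "\<dots> = sum ?f (range ?g)"
    by simp
  also have "\<dots> = (\<Sum>y\<in>UNIV. ?f (?g y))"
    by (subst sum.reindex) (auto simp: inj_on_def)
  finally show ?thesis
    by (simp add: lattice_lift_def)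
qed

text \<open>Finitely many paths lead from \<open>x\<close> to \<open>y2\<close>, and each reaches a single lattice point. This
  justifies exchanging sums over the whole lattice with sums over states, against arbitrary test
  functions.\<close>

lemma finite_support_lattice_propagator:
  "finite {k2. lattice_propagator h U \<psi> n x (y2, k2) \<noteq> 0}"
proof (induction n arbitrary: y2)
  case 0
  show ?case
    by (rule finite_subset[of _ "{snd x}"]) (auto simp: kernel_id_def split: if_splits)
next
  case (Suc n)
  let ?S = "\<lambda>y. (\<lambda>k. k + round (\<psi> n y y2 / h)) ` {k. lattice_propagator h U \<psi> n x (y, k) \<noteq> 0}"
  have "{k2. lattice_propagator h U \<psi> (Suc n) x (y2, k2) \<noteq> 0} \<subseteq> (\<Union>y. ?S y)"
  proof
    fix k2
    assume "k2 \<in> {k2. lattice_propagator h U \<psi> (Suc n) x (y2, k2) \<noteq> 0}"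
    then obtain y where "lattice_propagator h U \<psi> n x (y, k2 - round (\<psi> n y y2 / h)) \<noteq> 0"
      by (auto simp: kernel_comp_lattice_lift elim!: sum.not_neutral_contains_not_neutral)
    then show "k2 \<in> (\<Union>y. ?S y)"
      by (intro UN_I[of y] image_eqI[of _ _ "k2 - round (\<psi> n y y2 / h)"]) auto
  qed
  then show ?case
    by (rule finite_subset) (intro finite_UN_I finite_imageI Suc.IH finite)
qed

lemma infsum_of_finite_sum:
  fixes f :: "'i \<Rightarrow> 'a \<Rightarrow> 'b::{topological_comm_monoid_add, t2_space}"
  assumes "finite A" "\<And>i. i \<in> A \<Longrightarrow> f i summable_on S"
  shows "(\<Sum>\<^sub>\<infinity>x\<in>S. \<Sum>i\<in>A. f i x) = (\<Sum>i\<in>A. \<Sum>\<^sub>\<infinity>x\<in>S. f i x)"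
proof -
  have "((\<lambda>x. \<Sum>i\<in>A. f i x) has_sum (\<Sum>i\<in>A. \<Sum>\<^sub>\<infinity>x\<in>S. f i x)) S"
    using assms by (induction A rule: finite_induct) (auto intro!: has_sum_add has_sum_0)
  then show ?thesis
    by (rule infsumI)
qed

lemma lattice_dist_propagator_Suc:
  "lattice_dist h (\<lambda>k2. lattice_propagator h U \<psi> (Suc n) x (y2, k2)) \<phi>
     = (\<Sum>y\<in>UNIV. lattice_dist h (\<lambda>k. lattice_propagator h U \<psi> n x (y, k))
          (\<lambda>J. complex_of_real (U n $ y $ y2) * \<phi> (J + h * real_of_int (round (\<psi> n y y2 / h)))))"
proof -
  let ?K = "\<lambda>y k. lattice_propagator h U \<psi> n x (y, k)"
  let ?r = "\<lambda>y. round (\<psi> n y y2 / h)"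
  let ?f = "\<lambda>y k2. complex_of_real (?K y (k2 - ?r y)) * complex_of_real (U n $ y $ y2)
              * \<phi> (h * real_of_int k2)"
  have summable: "?f y summable_on UNIV" for y
  proof (rule finite_nonzero_values_imp_summable_on)
    have "{k2 \<in> UNIV. ?f y k2 \<noteq> 0} \<subseteq> (\<lambda>k. k + ?r y) ` {k. ?K y k \<noteq> 0}"
      by (auto intro!: image_eqI[of _ _ "_ - ?r y"])
    then show "finite {k2 \<in> UNIV. ?f y k2 \<noteq> 0}"
      by (rule finite_subset) (intro finite_imageI finite_support_lattice_propagator)
  qed
  have "lattice_dist h (\<lambda>k2. lattice_propagator h U \<psi> (Suc n) x (y2, k2)) \<phi>
      = (\<Sum>\<^sub>\<infinity>k2. \<Sum>y\<in>UNIV. ?f y k2)"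
    by (simp add: lattice_dist_def kernel_comp_lattice_lift sum_distrib_right)
  also have "\<dots> = (\<Sum>y\<in>UNIV. \<Sum>\<^sub>\<infinity>k2. ?f y k2)"
    by (rule infsum_of_finite_sum) (auto intro: summable)
  also have "\<dots> = (\<Sum>y\<in>UNIV. \<Sum>\<^sub>\<infinity>k. ?f y (k + ?r y))"
    by (intro sum.cong refl infsum_reindex_bij_betw[symmetric] bij_plus_right)
  finally show ?thesis
    by (simp add: lattice_dist_def algebra_simps)
qed

lemma lattice_round_tendsto:
  "((\<lambda>h. h * real_of_int (round (c / h))) \<longlongrightarrow> c) (at_right 0)"
proof (rule Lim_transform2)
  show "((\<lambda>_. c) \<longlongrightarrow> c) (at_right 0)"
    by simp
  show "((\<lambda>h. c - h * real_of_int (round (c / h))) \<longlongrightarrow> 0) (at_right 0)"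
  proof (rule Lim_null_comparison)
    show "\<forall>\<^sub>F h in at_right 0. norm (c - h * real_of_int (round (c / h))) \<le> h / 2"
      using eventually_at_right_less[of 0]
    proof eventually_elim
      case (elim h)
      then have "\<bar>c - h * real_of_int (round (c / h))\<bar> = h * \<bar>real_of_int (round (c / h)) - c / h\<bar>"
        by (simp add: abs_mult_pos' right_diff_distrib abs_minus_commute)
      also have "\<dots> \<le> h * (1 / 2)"
        using elim by (intro mult_left_mono of_int_round_abs_le) auto
      finally show ?case
        by simp
    qed
    have "((\<lambda>h::real. h / 2) \<longlongrightarrow> 0 / 2) (at_right 0)"
      by (intro tendsto_intros) auto
    then show "((\<lambda>h::real. h / 2) \<longlongrightarrow> 0) (at_right 0)"
      by simp
  qed
qed

text \<open>Pointwise convergence of the test functions would not suffice: they are evaluated at lattice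
  points that move with \<open>h\<close>. Continuous convergence is what survives composition with the moving
  shifts.\<close>

lemma lattice_propagator_tendsto:
  fixes \<Phi> :: "real \<Rightarrow> real \<Rightarrow> complex"
  assumes "\<And>X J. (X \<longlongrightarrow> J) (at_right 0) \<Longrightarrow> ((\<lambda>h. \<Phi> h (X h)) \<longlongrightarrow> \<phi> J) (at_right 0)"
  shows "((\<lambda>h. lattice_dist h
             (\<lambda>k2. lattice_propagator h U \<psi> n (y1, round (J1 / h)) (y2, k2)) (\<Phi> h))
           \<longlongrightarrow> dist_propagator U \<psi> n y1 J1 y2 \<phi>) (at_right 0)"
  using assms
proof (induction n arbitrary: y2 \<Phi> \<phi>)
  case 0
  have "lattice_dist h (\<lambda>k2. kernel_id (y1, round (J1 / h)) (y2, k2)) (\<Phi> h)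
      = (if y1 = y2 then \<Phi> h (h * real_of_int (round (J1 / h))) else 0)" for h
  proof -
    have "lattice_dist h (\<lambda>k2. kernel_id (y1, round (J1 / h)) (y2, k2)) (\<Phi> h)
        = (\<Sum>\<^sub>\<infinity>k\<in>{round (J1 / h)}. if y1 = y2 then \<Phi> h (h * real_of_int k) else 0)"
      unfolding lattice_dist_def by (rule infsum_cong_neutral) (auto simp: kernel_id_def)
    then show ?thesis
      by simp
  qed
  then show ?case
    using 0[OF lattice_round_tendsto[of J1]] by (simp add: dist_kernel_id_def)
next
  case (Suc n)
  show ?case
    unfolding lattice_dist_propagator_Suc dist_propagator_Suc
  proof (intro tendsto_sum Suc.IH)
    fix y and X :: "real \<Rightarrow> real" and J
    assume "(X \<longlongrightarrow> J) (at_right 0)"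
    then have "((\<lambda>h. X h + h * real_of_int (round (\<psi> n y y2 / h))) \<longlongrightarrow> J + \<psi> n y y2) (at_right 0)"
      by (intro tendsto_add lattice_round_tendsto)
    then show "((\<lambda>h. complex_of_real (U n $ y $ y2)
          * \<Phi> h (X h + h * real_of_int (round (\<psi> n y y2 / h))))
        \<longlongrightarrow> complex_of_real (U n $ y $ y2) * \<phi> (J + \<psi> n y y2)) (at_right 0)"
      by (intro tendsto_mult tendsto_const Suc.prems)
  qed
qed

section \<open>The joint propagator as a lattice limit and as a Fourier integral\<close>

theorem theorem27:
  fixes L :: "real \<Rightarrow> real^'y::finite^'y"
    and \<Delta>T :: real
    and t :: "nat \<Rightarrow> real"
    and n :: nat
    and U :: "nat \<Rightarrow> real^'y^'y"
    and \<psi> :: "nat \<Rightarrow> 'y \<Rightarrow> 'y \<Rightarrow> real"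
    and y1 y2 :: 'y
    and J1 :: real
  assumes "\<Delta>T > 0"
    and "\<And>i. t i = real i * \<Delta>T"
    and "\<And>s. s \<in> {t 0..t n} \<Longrightarrow> markov_generator (L s)"
    and "\<And>s. s \<in> {t 0..t n} \<Longrightarrow> L s = L (t 0)"
    and "\<And>i. i < n \<Longrightarrow> has_ordered_exp L (t i) (t (Suc i)) (U i)"
  shows "let W = time_ordered_prod dist_kernel_comp dist_kernel_id
                   (\<lambda>i. dist_lift (U i) (\<psi> i)) n y1 J1 y2
         in dist_tendsto
              (\<lambda>h. lattice_dist h
                 (\<lambda>k2. time_ordered_prod kernel_comp kernel_id
                         (\<lambda>i. lattice_lift h (U i) (\<psi> i)) n (y1, round (J1 / h)) (y2, k2)))
              W (at_right 0)
          \<and> has_dist_integral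
              (\<lambda>p. regular_dist (\<lambda>J2. exp (\<i> * complex_of_real (p * (J2 - J1))) / (2 * pi)
                     * matrix_prod (\<lambda>i. fourier_lift (U i) (\<psi> i) p) n $ y1 $ y2))
              W"
  unfolding Let_def dist_tendsto_def
  by (intro conjI allI impI lattice_propagator_tendsto has_dist_integral_fourier_propagator
      isCont_tendsto_compose[OF schwartz_isCont])

end
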